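(* Let $X$ be a finite skew brace. For each $n\ge0$, $R_n(X)\le D_n(X)$, and the final terms of the descending chains $(R_n(X))$ and $(D_n(X))$ coincide with $P_L(X)$. In particular, the following are equivalent: (1) $X$ is KSV-solvable; (2) $R_n(X)=0$ for some $n$; (3) $P_L(X)=0$.
   Context: A skew (left) brace is a triple $X=(X,+,\cdot)$ such that $(X,+)$ and $(X,\cdot)$ are groups on the same set and $a\cdot(b+c)=a\cdot b-a+a\cdot c$ for all $a,b,c\in X$. The common identity is $0$. A subskew brace is a subset that is a subgroup of both groups. Put $\lambda_a(b)=-a+a\cdot b$ and $a*b=\lambda_a(b)-b$; for subsets $S,T$, $S*T$ is the subgroup of $(X,+)$ generated by all $s*t$, $s\in S$, $t\in T$. An ideal of $X$ is a subgroup of $(X,+)$ that is invariant under every $\lambda_a$ and normal in both $(X,+)$ and $(X,\cdot)$. The left series is $X^1=X$, $X^{n+1}=X*X^n$; $X$ is left nilpotent if $X^n=0$ for some $n$. The left-nilpotent residual $\mathfrak{R}_L(X)$ is the intersection of all ideals $I$ of $X$ such that $X/I$ is left nilpotent. Set $R_0(X)=X$, $R_{n+1}(X)=\mathfrak{R}_L(R_n(X))$, and $D_0(X)=X$, $D_{n+1}(X)=D_n(X)*D_n(X)$ for $n\ge0$; both are descending chains of subskew braces. $X$ is KSV-solvable if $D_n(X)=0$ for some $n$. The final term of a descending chain in a finite skew brace is its eventual constant value. $P_L(X)$ denotes the final term of $(R_n(X))$; it is the largest subskew brace $C\le X$ satisfying $C*C=C$. *)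

theory Defs
  imports "HOL-Algebra.AbelCoset" "HOL-Algebra.Generated_Groups"
begin

text \<open>
  A skew brace is carried by the \<open>ring\<close> record of HOL-Algebra: \<open>\<otimes>\<close> is its multiplication \<open>\<cdot>\<close> and
  \<open>\<oplus>\<close> its addition, which need not be commutative (so \<open>abelian_group\<close> does not apply).
\<close>

locale skew_brace = multiplicative: group X + additive: group "add_monoid X"
  for X (structure) +
  assumes brace_distrib:
    "\<lbrakk>a \<in> carrier X; b \<in> carrier X; c \<in> carrier X\<rbrakk>
      \<Longrightarrow> a \<otimes> (b \<oplus> c) = (a \<otimes> b \<ominus> a) \<oplus> a \<otimes> c"

definition brace_lambda :: "('a, 'm) ring_scheme \<Rightarrow> 'a \<Rightarrow> 'a \<Rightarrow> 'a" where
  "brace_lambda X a b = (\<ominus>\<^bsub>X\<^esub> a) \<oplus>\<^bsub>X\<^esub> (a \<otimes>\<^bsub>X\<^esub> b)"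

definition star :: "('a, 'm) ring_scheme \<Rightarrow> 'a \<Rightarrow> 'a \<Rightarrow> 'a" where
  "star X a b = brace_lambda X a b \<ominus>\<^bsub>X\<^esub> b"

definition set_star :: "('a, 'm) ring_scheme \<Rightarrow> 'a set \<Rightarrow> 'a set \<Rightarrow> 'a set" where
  "set_star X S T = generate (add_monoid X) {star X s t | s t. s \<in> S \<and> t \<in> T}"

definition subskew_brace :: "'a set \<Rightarrow> ('a, 'm) ring_scheme \<Rightarrow> bool" where
  "subskew_brace H X \<longleftrightarrow> subgroup H (add_monoid X) \<and> subgroup H X"

definition brace_ideal :: "'a set \<Rightarrow> ('a, 'm) ring_scheme \<Rightarrow> bool" where
  "brace_ideal I X \<longleftrightarrow>
    subgroup I (add_monoid X) \<and>
    (\<forall>a \<in> carrier X. brace_lambda X a ` I \<subseteq> I) \<and>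
    I \<lhd> add_monoid X \<and> I \<lhd> X"

text \<open>
  For an ideal \<open>I\<close> the additive and the multiplicative cosets of \<open>I\<close> agree, so the additive
  cosets carry both factor groups.
\<close>

definition brace_quotient :: "('a, 'm) ring_scheme \<Rightarrow> 'a set \<Rightarrow> 'a set ring" where
  "brace_quotient X I =
    \<lparr>carrier = a_rcosets\<^bsub>X\<^esub> I, mult = set_mult X, one = I, zero = I, add = set_add X\<rparr>"

text \<open>The index is shifted: \<open>left_series X n\<close> is the term $X^{n+1}$ of the left series.\<close>

primrec left_series :: "('a, 'm) ring_scheme \<Rightarrow> nat \<Rightarrow> 'a set" where
  "left_series X 0 = carrier X"
| "left_series X (Suc n) = set_star X (carrier X) (left_series X n)"

definition left_nilpotent :: "('a, 'm) ring_scheme \<Rightarrow> bool" where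
  "left_nilpotent X \<longleftrightarrow> (\<exists>n. left_series X n = {\<zero>\<^bsub>X\<^esub>})"

definition left_nilpotent_residual :: "('a, 'm) ring_scheme \<Rightarrow> 'a set" where
  "left_nilpotent_residual X =
    \<Inter>{I. brace_ideal I X \<and> left_nilpotent (brace_quotient X I)}"

primrec residual_series :: "('a, 'm) ring_scheme \<Rightarrow> nat \<Rightarrow> 'a set" where
  "residual_series X 0 = carrier X"
| "residual_series X (Suc n) = left_nilpotent_residual (X\<lparr>carrier := residual_series X n\<rparr>)"

primrec derived_star_series :: "('a, 'm) ring_scheme \<Rightarrow> nat \<Rightarrow> 'a set" where
  "derived_star_series X 0 = carrier X"
| "derived_star_series X (Suc n) =
    set_star X (derived_star_series X n) (derived_star_series X n)"

definition KSV_solvable :: "('a, 'm) ring_scheme \<Rightarrow> bool" where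
  "KSV_solvable X \<longleftrightarrow> (\<exists>n. derived_star_series X n = {\<zero>\<^bsub>X\<^esub>})"

definition is_final_term :: "'a set \<Rightarrow> (nat \<Rightarrow> 'a set) \<Rightarrow> bool" where
  "is_final_term T S \<longleftrightarrow> (\<exists>N. \<forall>n\<ge>N. S n = T)"

text \<open>
  A final term is unique when it exists; it exists for every descending chain of subsets of a
  finite carrier, so the description below is meaningful for finite \<open>X\<close>.
\<close>

definition P_L :: "('a, 'm) ring_scheme \<Rightarrow> 'a set" where
  "P_L X = (THE T. is_final_term T (residual_series X))"

lemma (in skew_brace) one_eq_zero: "\<one> = \<zero>"
proof -
  have z: "\<zero> \<in> carrier X" using additive.one_closed by simp
  have z2: "\<zero> \<oplus> \<zero> = \<zero>" using additive.l_one[of "\<zero>"] z by simp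
  have "\<one> \<otimes> (\<zero> \<oplus> \<zero>) = (\<one> \<otimes> \<zero> \<ominus> \<one>) \<oplus> \<one> \<otimes> \<zero>"
    by (rule brace_distrib) (use z in auto)
  then have "\<zero> = (\<zero> \<oplus> (\<ominus> \<one>)) \<oplus> \<zero>" using z z2 by (simp add: a_minus_def)
  then have "\<zero> = \<ominus> \<one>"
    using additive.l_one[of "\<ominus> \<one>"] additive.r_one[of "\<ominus> \<one>"] additive.inv_closed[of "\<one>"]
    by (simp add: a_inv_def)
  then show ?thesis
    using additive.inv_inv[of "\<one>"] additive.inv_one by (simp add: a_inv_def)
qed

lemma (in skew_brace) subskew_brace_imp_skew_brace:
  assumes "subskew_brace H X"
  shows "skew_brace (X\<lparr>carrier := H\<rparr>)"
proof -
  have a: "subgroup H (add_monoid X)" and m: "subgroup H X"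
    using assms by (auto simp: subskew_brace_def)
  have sub: "x \<in> carrier X" if "x \<in> H" for x using subgroup.mem_carrier[OF m that] .
  have inv: "a_inv (X\<lparr>carrier := H\<rparr>) x = \<ominus> x" if "x \<in> H" for x
    using additive.m_inv_consistent[OF a that] by (simp add: a_inv_def)
  show ?thesis
    unfolding skew_brace_def skew_brace_axioms_def
    using multiplicative.subgroup_imp_group[OF m] additive.subgroup_imp_group[OF a]
    by (auto simp: a_minus_def inv sub brace_distrib)
qed

context skew_brace
begin

context
  fixes I assumes I: "brace_ideal I X"
begin

interpretation A: normal I "add_monoid X" using I by (simp add: brace_ideal_def)
interpretation M: normal I X using I by (simp add: brace_ideal_def)

lemma ideal_rcoset_eq:
  assumes a: "a \<in> carrier X"
  shows "a_r_coset X I a = r_coset X I a"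
proof -
  have la: "a \<otimes> i = a \<oplus> brace_lambda X a i" if "i \<in> I" for i
    using a M.mem_carrier[OF that] additive.m_assoc[of a "\<ominus> a" "a \<otimes> i"]
      additive.r_inv[of a] additive.inv_closed[of a]
      additive.l_one[of "a \<otimes> i"]
    by (simp add: brace_lambda_def a_inv_def)
  have lI: "brace_lambda X a i \<in> I" if "i \<in> I" for i
    using I a that by (auto simp: brace_ideal_def)
  have surj: "\<exists>j\<in>I. i = brace_lambda X a j" if i: "i \<in> I" for i
  proof -
    define b where "b = inv a"
    have b: "b \<in> carrier X" "a \<otimes> b = \<one>" using a by (auto simp: b_def)
    have ic: "i \<in> carrier X" using i M.mem_carrier by blast
    define j where "j = brace_lambda X b i"
    have j: "j \<in> I" using I b(1) i by (auto simp: j_def brace_ideal_def)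
    have nb: "\<ominus> b \<in> carrier X" using additive.inv_closed[of b] b(1) by (simp add: a_inv_def)
    have na: "\<ominus> a \<in> carrier X" using additive.inv_closed[of a] a by (simp add: a_inv_def)
    have ac: "x \<oplus> y \<in> carrier X" if "x \<in> carrier X" "y \<in> carrier X" for x y
      using additive.m_closed that by simp
    have bj: "b \<oplus> j = b \<otimes> i"
      using additive.m_assoc[of b "\<ominus> b" "b \<otimes> i"] additive.r_inv[of b] b(1) ic nb
        additive.l_one[of "b \<otimes> i"] by (simp add: j_def brace_lambda_def a_inv_def)
    have jc: "j \<in> carrier X" using j M.mem_carrier by blast
    have "i = a \<otimes> (b \<oplus> j)" using bj a b ic multiplicative.m_assoc[of a b i] by simp
    also have "\<dots> = (\<one> \<oplus> (\<ominus> a)) \<oplus> a \<otimes> j"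
      using brace_distrib[OF a b(1) jc] b(2) by (simp add: a_minus_def)
    also have "\<dots> = brace_lambda X a j"
      using additive.l_one[of "\<ominus> a"] na by (simp add: one_eq_zero brace_lambda_def)
    finally show ?thesis using j by blast
  qed
  have "l_coset X a I = l_coset (add_monoid X) a I"
    using la lI surj by (fastforce simp: l_coset_def)
  then show ?thesis using A.coset_eq M.coset_eq a by (simp add: a_r_coset_def)
qed

lemma skew_brace_quotient: "skew_brace (brace_quotient X I)"
proof -
  have car: "a_rcosets\<^bsub>X\<^esub> I = rcosets\<^bsub>X\<^esub> I"
    using ideal_rcoset_eq by (auto simp: A_RCOSETS_def RCOSETS_def a_r_coset_def)
  let ?Q = "brace_quotient X I"
  have addQ: "add_monoid ?Q = add_monoid X Mod I"
    by (simp add: brace_quotient_def FactGroup_def A_RCOSETS_def set_add_def)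
  have g1: "group (add_monoid ?Q)" unfolding addQ by (rule A.factorgroup_is_group)
  have g2: "group ?Q"
    using M.factorgroup_is_group
    unfolding brace_quotient_def FactGroup_def car
    by (simp add: group_def monoid_def group_axioms_def Units_def)
  have amul: "set_add X (r_coset X I a) (r_coset X I b) = r_coset X I (a \<oplus> b)"
    if "a \<in> carrier X" "b \<in> carrier X" for a b
    using A.rcos_sum[of a b] that ideal_rcoset_eq[of a] ideal_rcoset_eq[of b]
      ideal_rcoset_eq[of "a \<oplus> b"] additive.m_closed[of a b]
    by (simp add: set_add_def a_r_coset_def)
  have ainv: "a_inv ?Q (r_coset X I a) = r_coset X I (\<ominus> a)" if "a \<in> carrier X" for a
  proof -
    have "a_inv ?Q (r_coset X I a) = inv\<^bsub>add_monoid X Mod I\<^esub> (r_coset (add_monoid X) I a)"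
      unfolding a_inv_def addQ using ideal_rcoset_eq[OF that] by (simp add: a_r_coset_def)
    also have "\<dots> = set_inv\<^bsub>add_monoid X\<^esub> (r_coset (add_monoid X) I a)"
      using that by (intro A.inv_FactGroup) (auto simp: FactGroup_def RCOSETS_def)
    also have "\<dots> = r_coset (add_monoid X) I (\<ominus> a)"
      using A.rcos_inv[of a] that by (simp add: a_inv_def)
    finally show ?thesis
      using ideal_rcoset_eq[of "\<ominus> a"] additive.inv_closed[of a] that
      by (simp add: a_inv_def a_r_coset_def)
  qed
  have ax: "A \<otimes>\<^bsub>?Q\<^esub> (B \<oplus>\<^bsub>?Q\<^esub> C) = (A \<otimes>\<^bsub>?Q\<^esub> B \<ominus>\<^bsub>?Q\<^esub> A) \<oplus>\<^bsub>?Q\<^esub> A \<otimes>\<^bsub>?Q\<^esub> C"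
    if "A \<in> carrier ?Q" "B \<in> carrier ?Q" "C \<in> carrier ?Q" for A B C
  proof -
    have rep: "\<exists>d\<in>carrier X. D = r_coset X I d" if "D \<in> carrier ?Q" for D
      using that unfolding brace_quotient_def car by (simp add: RCOSETS_def)
    obtain a where a: "a \<in> carrier X" "A = r_coset X I a" using rep \<open>A \<in> carrier ?Q\<close> by blast
    obtain b where b: "b \<in> carrier X" "B = r_coset X I b" using rep \<open>B \<in> carrier ?Q\<close> by blast
    obtain c where c: "c \<in> carrier X" "C = r_coset X I c" using rep \<open>C \<in> carrier ?Q\<close> by blast
    note e = a(1) b(1) c(1) a(2) b(2) c(2)
    have cl: "b \<oplus> c \<in> carrier X" "\<ominus> a \<in> carrier X" "a \<otimes> b \<oplus> (\<ominus> a) \<in> carrier X"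
      using additive.m_closed[of b c] additive.inv_closed[of a]
        additive.m_closed[of "a \<otimes> b" "\<ominus> a"] e(1-3) by (auto simp: a_inv_def)
    show ?thesis
      unfolding e(4-6) a_minus_def ainv[OF e(1)]
      using e(1-3) cl brace_distrib[OF e(1-3)]
      by (simp add: brace_quotient_def amul M.rcos_sum a_minus_def)
  qed
  show ?thesis
    unfolding skew_brace_def skew_brace_axioms_def using g1 g2 ax by blast
qed

end

end

end

theory Submission
  imports Defs
begin

text \<open>
  Both chains are built from the same comparison, carried out inside each of their terms. Let \<open>Y\<close>
  be a skew brace.

  On the one hand, \<open>Y * Y\<close> is an ideal (\<open>brace_ideal_square\<close>) and every star product vanishes in
  \<open>Y / (Y * Y)\<close>, so this quotient is left nilpotent in one step. Hence the left-nilpotent residual of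
  \<open>Y\<close> lies in \<open>Y * Y\<close> (\<open>left_nilpotent_residual_subset_square\<close>). As \<open>*\<close> is monotone in both
  arguments, induction on \<open>n\<close> puts the \<open>n\<close>-th residual into the \<open>n\<close>-th derived term.

  On the other hand, let \<open>S \<subseteq> Y\<close> satisfy \<open>S \<subseteq> S * S\<close>. If \<open>I\<close> is an ideal, the image of \<open>S\<close> in
  \<open>Y / I\<close> inherits this property and so lies in every term of the left series of \<open>Y / I\<close>. When that
  quotient is left nilpotent, the image is zero, that is \<open>S \<subseteq> I\<close>. Therefore \<open>S\<close> survives in the residual
  of \<open>Y\<close> (\<open>star_perfect_subset_residual\<close>), and by induction in all iterated residuals.

  In a finite skew brace both chains become constant. The final term \<open>S\<close> of the derived chain
  satisfies \<open>S * S = S\<close>, so by the second point it is contained in the final term of the residual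
  chain; the first point gives the reverse inclusion. The three solvability conditions then all
  say that this common final term is zero, since \<open>{\<zero>}\<close> is contained in every term and a descending
  chain stays there once it has reached it.
\<close>

section \<open>Calculation in a skew brace\<close>

context skew_brace
begin

text \<open>
  The group laws of the additive group, expressed by the operations \<open>\<oplus>\<close>, \<open>\<ominus>\<close>, \<open>\<zero>\<close> instead of those
  of \<open>add_monoid X\<close>. Collected in \<open>add_simps\<close>, they rewrite every sum of signed elements to its reduced
  word, which decides the identities of noncommutative addition that occur below.
\<close>

lemmas add_closed = additive.m_closed[simplified]
lemmas neg_closed = additive.inv_closed[folded a_inv_def, simplified]
lemmas zero_in = additive.one_closed[simplified]
lemmas add_assoc = additive.m_assoc[simplified]
lemmas add_lone = additive.l_one[simplified]
lemmas add_rone = additive.r_one[simplified]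
lemmas add_linv = additive.l_inv[folded a_inv_def, simplified]
lemmas add_rinv = additive.r_inv[folded a_inv_def, simplified]
lemmas neg_neg = additive.inv_inv[folded a_inv_def, simplified]
lemmas neg_add = additive.inv_mult_group[folded a_inv_def, simplified]
lemmas neg_zero = additive.inv_one[folded a_inv_def, simplified]

lemma add_neg_cancel:
  "\<lbrakk>a \<in> carrier X; b \<in> carrier X\<rbrakk> \<Longrightarrow> a \<oplus> (\<ominus> a \<oplus> b) = b"
  "\<lbrakk>a \<in> carrier X; b \<in> carrier X\<rbrakk> \<Longrightarrow> \<ominus> a \<oplus> (a \<oplus> b) = b"
  by (simp_all add: add_assoc[symmetric] add_rinv add_linv add_lone neg_closed)

lemmas add_simps = a_minus_def add_closed neg_closed zero_in add_assoc add_lone add_rone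
  add_linv add_rinv neg_neg neg_add neg_zero add_neg_cancel

lemma lambda_closed: "\<lbrakk>a \<in> carrier X; b \<in> carrier X\<rbrakk> \<Longrightarrow> brace_lambda X a b \<in> carrier X"
  by (simp add: brace_lambda_def add_simps)

lemma star_closed: "\<lbrakk>a \<in> carrier X; b \<in> carrier X\<rbrakk> \<Longrightarrow> star X a b \<in> carrier X"
  by (simp add: star_def lambda_closed add_simps)

lemma mult_eq_add_lambda:
  "\<lbrakk>a \<in> carrier X; b \<in> carrier X\<rbrakk> \<Longrightarrow> a \<otimes> b = a \<oplus> brace_lambda X a b"
  by (simp add: brace_lambda_def add_simps)

lemma lambda_add:
  "\<lbrakk>a \<in> carrier X; b \<in> carrier X; c \<in> carrier X\<rbrakk> \<Longrightarrow>
    brace_lambda X a (b \<oplus> c) = brace_lambda X a b \<oplus> brace_lambda X a c"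
  by (simp add: brace_lambda_def brace_distrib add_simps)

lemma lambda_group_hom:
  assumes "a \<in> carrier X"
  shows "group_hom (add_monoid X) (add_monoid X) (brace_lambda X a)"
  unfolding group_hom_def group_hom_axioms_def hom_def
  using assms additive.group_axioms by (auto simp: lambda_closed lambda_add)

lemma lambda_neg:
  assumes "a \<in> carrier X" "b \<in> carrier X"
  shows "brace_lambda X a (\<ominus> b) = \<ominus> brace_lambda X a b"
  using group_hom.hom_inv[OF lambda_group_hom[OF assms(1)], of b] assms(2)
  by (simp add: a_inv_def)

text \<open>
  Expanding both sides of \<open>(a \<otimes> b) \<otimes> c = a \<otimes> (b \<otimes> c)\<close> by \<open>x \<otimes> y = x \<oplus> \<lambda>\<^sub>x y\<close> and cancelling
  \<open>a \<otimes> b\<close> on the left shows that \<open>\<lambda>\<close> is an action of the multiplicative group.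
\<close>

lemma lambda_mult:
  assumes "a \<in> carrier X" "b \<in> carrier X" "c \<in> carrier X"
  shows "brace_lambda X (a \<otimes> b) c = brace_lambda X a (brace_lambda X b c)"
proof -
  have "a \<otimes> (b \<otimes> c) = (a \<oplus> brace_lambda X a b) \<oplus> brace_lambda X a (brace_lambda X b c)"
    using assms by (simp add: mult_eq_add_lambda[of b c] brace_distrib lambda_closed
        mult_eq_add_lambda[of a "brace_lambda X b c"] mult_eq_add_lambda[of a b] add_simps)
  then have "(a \<otimes> b) \<otimes> c = (a \<otimes> b) \<oplus> brace_lambda X a (brace_lambda X b c)"
    using assms by (simp add: multiplicative.m_assoc mult_eq_add_lambda[symmetric])
  then show ?thesis
    using assms by (simp add: brace_lambda_def[of X "a \<otimes> b"] lambda_closed add_neg_cancel)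
qed

text \<open>
  Each \<open>\<lambda>\<^sub>x\<close> permutes the star products; this makes \<open>X * X\<close> invariant under \<open>\<lambda>\<close>.
\<close>

lemma lambda_star:
  assumes "x \<in> carrier X" "a \<in> carrier X" "b \<in> carrier X"
  shows "brace_lambda X x (star X a b) = star X (x \<otimes> a \<otimes> inv x) (brace_lambda X x b)"
proof -
  have "brace_lambda X (x \<otimes> a \<otimes> inv x) (brace_lambda X x b)
      = brace_lambda X (x \<otimes> a \<otimes> inv x \<otimes> x) b"
    using assms by (intro lambda_mult[symmetric]) auto
  also have "x \<otimes> a \<otimes> inv x \<otimes> x = x \<otimes> a"
    using assms by (simp add: multiplicative.m_assoc)
  finally show ?thesis
    using assms by (simp add: star_def a_minus_def lambda_add lambda_neg lambda_mult
        lambda_closed neg_closed)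
qed

text \<open>
  Additivity of \<open>\<lambda>\<^sub>a\<close> in the form that exhibits an additive conjugate of a star product by means of two
  star products; this makes \<open>X * X\<close> additively normal.
\<close>

lemma star_add_right:
  assumes "a \<in> carrier X" "b \<in> carrier X" "c \<in> carrier X"
  shows "b \<oplus> star X a c \<ominus> b = \<ominus> star X a b \<oplus> star X a (b \<oplus> c)"
  using assms by (simp add: star_def lambda_add lambda_closed add_simps)

section \<open>Ideals and the square\<close>

lemma set_star_subgroup:
  assumes "S \<subseteq> carrier X" "T \<subseteq> carrier X"
  shows "subgroup (set_star X S T) (add_monoid X)"
  unfolding set_star_def
  by (rule additive.generate_is_subgroup) (use assms in \<open>auto intro!: star_closed\<close>)

lemma star_in_set_star: "\<lbrakk>s \<in> S; t \<in> T\<rbrakk> \<Longrightarrow> star X s t \<in> set_star X S T"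
  unfolding set_star_def by (blast intro: generate.incl)

lemma set_star_mono:
  "\<lbrakk>S \<subseteq> S'; T \<subseteq> T'\<rbrakk> \<Longrightarrow> set_star X S T \<subseteq> set_star X S' T'"
  unfolding set_star_def by (intro additive.mono_generate) blast

text \<open>
  Multiplicative normality comes from the star condition: modulo an additively normal \<open>I\<close>, the
  products \<open>i \<otimes> y = i \<oplus> (i * y) \<oplus> y\<close> and \<open>y \<otimes> i = y \<oplus> \<lambda>\<^sub>y i\<close> both lie in the coset of \<open>y\<close>.
  For \<open>I = X * X\<close> this condition is immediate.
\<close>

lemma brace_idealI:
  assumes sub: "subgroup I (add_monoid X)"
    and lam: "\<And>a i. \<lbrakk>a \<in> carrier X; i \<in> I\<rbrakk> \<Longrightarrow> brace_lambda X a i \<in> I"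
    and conj: "\<And>a i. \<lbrakk>a \<in> carrier X; i \<in> I\<rbrakk> \<Longrightarrow> a \<oplus> i \<ominus> a \<in> I"
    and star: "\<And>i a. \<lbrakk>i \<in> I; a \<in> carrier X\<rbrakk> \<Longrightarrow> star X i a \<in> I"
  shows "brace_ideal I X"
proof -
  have car: "i \<in> carrier X" if "i \<in> I" for i using subgroup.mem_carrier[OF sub that] by simp
  have add: "i \<oplus> j \<in> I" if "i \<in> I" "j \<in> I" for i j
    using subgroup.m_closed[OF sub that] by simp
  have neg: "\<ominus> i \<in> I" if "i \<in> I" for i
    using additive.subgroupE(3)[OF sub that] by (simp add: a_inv_def)
  have zero: "\<zero> \<in> I" using subgroup.one_closed[OF sub] by simp
  have A: "I \<lhd> add_monoid X"
    using sub conj by (simp add: additive.normal_inv_iff a_minus_def a_inv_def)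
  have M: "subgroup I X"
  proof (rule multiplicative.subgroupI)
    show "I \<subseteq> carrier X" "I \<noteq> {}" using car zero by auto
    fix i assume i: "i \<in> I"
    \<comment> \<open>The inverse of \<open>i\<close> is minus \<open>\<lambda>\<^bsub>inv i\<^esub> i\<close>, because their sum is \<open>inv i \<otimes> i = \<zero>\<close>.\<close>
    have "inv i \<oplus> brace_lambda X (inv i) i = \<zero>"
      using i car by (simp add: mult_eq_add_lambda[symmetric]) (simp add: one_eq_zero)
    then have "inv i = \<ominus> brace_lambda X (inv i) i"
      using i car additive.inv_equality[of "inv i" "brace_lambda X (inv i) i"]
      by (simp add: a_inv_def lambda_closed)
    then show "inv i \<in> I" using neg[OF lam[of "inv i" i]] i car by simp
  next
    fix i j assume "i \<in> I" "j \<in> I"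
    then show "i \<otimes> j \<in> I" using lam add car by (simp add: mult_eq_add_lambda)
  qed
  have "I \<lhd> X"
    unfolding multiplicative.normal_inv_iff
  proof (intro conjI M ballI)
    fix x i assume x: "x \<in> carrier X" and i: "i \<in> I"
    let ?y = "inv x"
    have y: "?y \<in> carrier X" using x by simp
    have ic: "i \<in> carrier X" using car i .
    \<comment> \<open>\<open>i \<otimes> ?y = ?y \<oplus> k\<close>, and since \<open>x \<otimes> ?y = \<zero>\<close>, the product of \<open>x\<close> with this sum is \<open>\<lambda>\<^sub>x k\<close>.\<close>
    define k where "k = \<ominus> ?y \<oplus> (i \<oplus> star X i ?y) \<oplus> ?y"
    have k: "k \<in> I"
      using conj[of "\<ominus> ?y" "i \<oplus> star X i ?y"] add star i y neg_closed[OF y]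
      by (simp add: k_def a_minus_def neg_neg)
    have "i \<otimes> ?y = ?y \<oplus> k"
      using y ic by (simp add: mult_eq_add_lambda k_def star_def lambda_closed add_simps)
    then have "x \<otimes> (i \<otimes> ?y) = brace_lambda X x k"
      using x y car[OF k] by (simp add: brace_distrib brace_lambda_def a_minus_def)
        (simp add: one_eq_zero add_lone neg_closed)
    then show "x \<otimes> i \<otimes> inv x \<in> I"
      using lam[OF x k] x ic by (simp add: multiplicative.m_assoc)
  qed
  then show ?thesis using sub lam A by (auto simp: brace_ideal_def)
qed

lemma brace_ideal_square: "brace_ideal (set_star X (carrier X) (carrier X)) X"
proof -
  let ?G = "{star X s t | s t. s \<in> carrier X \<and> t \<in> carrier X}"
  let ?I = "set_star X (carrier X) (carrier X)"
  have I: "?I = generate (add_monoid X) ?G" by (simp add: set_star_def)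
  have sub: "subgroup ?I (add_monoid X)" by (simp add: set_star_subgroup)
  have G: "?G \<subseteq> carrier (add_monoid X)" by (auto intro: star_closed)
  have gen: "star X a b \<in> ?I" if "a \<in> carrier X" "b \<in> carrier X" for a b
    using star_in_set_star that .
  have lam: "brace_lambda X x i \<in> ?I" if x: "x \<in> carrier X" and i: "i \<in> ?I" for x i
  proof -
    have "brace_lambda X x ` ?G \<subseteq> ?G"
      using x by (force simp: lambda_star lambda_closed)
    then have "generate (add_monoid X) (brace_lambda X x ` ?G) \<subseteq> ?I"
      unfolding I by (rule additive.mono_generate)
    then show ?thesis
      using i group_hom.generate_img[OF lambda_group_hom[OF x] G] unfolding I by blast
  qed
  have conj: "g \<oplus> i \<ominus> g \<in> ?I" if g: "g \<in> carrier X" and i: "i \<in> ?I" for g i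
  proof -
    let ?c = "\<lambda>x. g \<oplus> x \<ominus> g"
    have hom: "group_hom (add_monoid X) (add_monoid X) ?c"
      unfolding group_hom_def group_hom_axioms_def hom_def
      using g additive.group_axioms by (auto simp: add_simps)
    have "?c (star X a c) \<in> ?I" if "a \<in> carrier X" "c \<in> carrier X" for a c
      using subgroup.m_closed[OF sub additive.subgroupE(3)[OF sub gen[OF that(1) g]]
          gen[OF that(1) add_closed[OF g that(2)]]] star_add_right[OF that(1) g that(2)]
      by (simp add: a_inv_def)
    then have "?c ` ?G \<subseteq> ?I" by blast
    then have "generate (add_monoid X) (?c ` ?G) \<subseteq> ?I"
      by (rule additive.generate_subgroup_incl[OF _ sub])
    then show ?thesis
      using i group_hom.generate_img[OF hom G] unfolding I by blast
  qed
  have "star X i a \<in> ?I" if "i \<in> ?I" "a \<in> carrier X" for i a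
    using gen that subgroup.mem_carrier[OF sub that(1)] by simp
  with sub lam conj show ?thesis by (rule brace_idealI)
qed

lemma brace_ideal_subskew_brace: "brace_ideal I X \<Longrightarrow> subskew_brace I X"
  by (simp add: brace_ideal_def subskew_brace_def normal_imp_subgroup)

lemma brace_ideal_Inter:
  assumes ne: "\<I> \<noteq> {}" and id: "\<And>I. I \<in> \<I> \<Longrightarrow> brace_ideal I X"
  shows "brace_ideal (\<Inter>\<I>) X"
proof -
  have A: "subgroup (\<Inter>\<I>) (add_monoid X)"
    by (rule additive.subgroups_Inter) (use ne id in \<open>auto simp: brace_ideal_def\<close>)
  have M: "subgroup (\<Inter>\<I>) X"
    by (rule multiplicative.subgroups_Inter)
      (use ne id in \<open>auto simp: brace_ideal_def normal_imp_subgroup\<close>)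
  have lam: "\<forall>a\<in>carrier X. brace_lambda X a ` \<Inter>\<I> \<subseteq> \<Inter>\<I>"
    using id unfolding brace_ideal_def by blast
  have "\<Inter>\<I> \<lhd> add_monoid X"
    using A id unfolding brace_ideal_def additive.normal_inv_iff by blast
  moreover have "\<Inter>\<I> \<lhd> X"
    using M id unfolding brace_ideal_def multiplicative.normal_inv_iff by blast
  ultimately show ?thesis using A lam unfolding brace_ideal_def by blast
qed

section \<open>Quotients and the left-nilpotent residual\<close>

lemma hom_star:
  assumes Y: "skew_brace Y" and ha: "h \<in> hom (add_monoid X) (add_monoid Y)" and hm: "h \<in> hom X Y"
    and ab: "a \<in> carrier X" "b \<in> carrier X"
  shows "h (star X a b) = star Y (h a) (h b)"
proof -
  interpret Y: skew_brace Y by fact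
  interpret h: group_hom "add_monoid X" "add_monoid Y" h
    using ha additive.group_axioms Y.additive.group_axioms
    by (simp add: group_hom_def group_hom_axioms_def)
  have p: "h (x \<oplus> y) = h x \<oplus>\<^bsub>Y\<^esub> h y" if "x \<in> carrier X" "y \<in> carrier X" for x y
    using h.hom_mult that by simp
  have n: "h (\<ominus> x) = \<ominus>\<^bsub>Y\<^esub> h x" if "x \<in> carrier X" for x
    using h.hom_inv that by (simp add: a_inv_def)
  show ?thesis
    using ab hom_mult[OF hm ab]
    by (simp add: star_def brace_lambda_def a_minus_def p n add_closed neg_closed)
qed

lemma quotient_homs:
  assumes I: "brace_ideal I X"
  shows "(\<lambda>a. a_r_coset X I a) \<in> hom (add_monoid X) (add_monoid (brace_quotient X I))"
    and "(\<lambda>a. a_r_coset X I a) \<in> hom X (brace_quotient X I)"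
proof -
  have A: "I \<lhd> add_monoid X" and M: "I \<lhd> X" using I by (auto simp: brace_ideal_def)
  have addQ: "add_monoid (brace_quotient X I) = add_monoid X Mod I"
    by (simp add: brace_quotient_def FactGroup_def A_RCOSETS_def set_add_def)
  show "(\<lambda>a. a_r_coset X I a) \<in> hom (add_monoid X) (add_monoid (brace_quotient X I))"
    unfolding addQ a_r_coset_def by (rule normal.r_coset_hom_Mod[OF A])
  show "(\<lambda>a. a_r_coset X I a) \<in> hom X (brace_quotient X I)"
    using normal.rcos_sum[OF M] ideal_rcoset_eq[OF I]
    by (auto simp: hom_def brace_quotient_def A_RCOSETS_def RCOSETS_def a_r_coset_def)
qed

lemma carrier_quotient: "carrier (brace_quotient X I) = (\<lambda>a. a_r_coset X I a) ` carrier X"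
  by (auto simp: brace_quotient_def A_RCOSETS_def RCOSETS_def a_r_coset_def)

lemma coset_eq_ideal_iff:
  assumes "brace_ideal I X" "a \<in> carrier X"
  shows "a_r_coset X I a = I \<longleftrightarrow> a \<in> I"
proof -
  have "subgroup I (add_monoid X)" using assms(1) by (simp add: brace_ideal_def)
  then show ?thesis
    unfolding a_r_coset_def
    using additive.coset_join1[of I a] additive.coset_join2[of a I] assms(2) by auto
qed

lemma left_nilpotent_quotient_square:
  "left_nilpotent (brace_quotient X (set_star X (carrier X) (carrier X)))"
proof -
  let ?I = "set_star X (carrier X) (carrier X)"
  let ?Q = "brace_quotient X ?I"
  note I = brace_ideal_square
  interpret Q: skew_brace ?Q using skew_brace_quotient[OF I] .
  have "star ?Q A B = \<zero>\<^bsub>?Q\<^esub>" if AB: "A \<in> carrier ?Q" "B \<in> carrier ?Q" for A B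
  proof -
    obtain a b where a: "a \<in> carrier X" "A = a_r_coset X ?I a"
      and b: "b \<in> carrier X" "B = a_r_coset X ?I b"
      using AB unfolding carrier_quotient by blast
    have "star ?Q A B = a_r_coset X ?I (star X a b)"
      using hom_star[OF Q.skew_brace_axioms quotient_homs[OF I]] a b by simp
    also have "\<dots> = ?I"
      using coset_eq_ideal_iff[OF I] a b star_closed star_in_set_star by simp
    finally show ?thesis by (simp add: brace_quotient_def)
  qed
  then have "{star ?Q s t | s t. s \<in> carrier ?Q \<and> t \<in> carrier ?Q} \<subseteq> {\<zero>\<^bsub>?Q\<^esub>}" by auto
  then have "left_series ?Q (Suc 0) \<subseteq> generate (add_monoid ?Q) {\<zero>\<^bsub>?Q\<^esub>}"
    unfolding left_series.simps set_star_def[of ?Q] by (rule Q.additive.mono_generate)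
  also have "\<dots> = {\<zero>\<^bsub>?Q\<^esub>}" using Q.additive.generate_one by simp
  finally have "left_series ?Q (Suc 0) \<subseteq> {\<zero>\<^bsub>?Q\<^esub>}" .
  moreover have "\<zero>\<^bsub>?Q\<^esub> \<in> left_series ?Q (Suc 0)"
    using generate.one[of "add_monoid ?Q"] by (simp add: set_star_def)
  ultimately show ?thesis unfolding left_nilpotent_def by blast
qed

text \<open>
  The square is one of the ideals whose intersection is the residual.
\<close>

lemma left_nilpotent_residual_subset_square:
  "left_nilpotent_residual X \<subseteq> set_star X (carrier X) (carrier X)"
  unfolding left_nilpotent_residual_def
  using brace_ideal_square left_nilpotent_quotient_square by blast

lemma brace_ideal_left_nilpotent_residual: "brace_ideal (left_nilpotent_residual X) X"
  unfolding left_nilpotent_residual_def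
  using brace_ideal_square left_nilpotent_quotient_square by (intro brace_ideal_Inter) auto

text \<open>
  In a quotient by \<open>I\<close>, the image of \<open>S\<close> lies in each term of the left series: if it lies in the
  term \<open>n\<close>, its star products with itself lie in the next term, which therefore contains the subgroup
  generated by them, and this subgroup contains the image. Left nilpotency of the quotient then
  forces the image to be zero.
\<close>

lemma star_perfect_subset_residual:
  assumes S: "S \<subseteq> carrier X" and perfect: "S \<subseteq> set_star X S S"
  shows "S \<subseteq> left_nilpotent_residual X"
  unfolding left_nilpotent_residual_def
proof (rule Inter_greatest, clarify)
  fix I x assume I: "brace_ideal I X" and nil: "left_nilpotent (brace_quotient X I)" and x: "x \<in> S"
  let ?Q = "brace_quotient X I" and ?h = "\<lambda>a. a_r_coset X I a"
  interpret Q: skew_brace ?Q using skew_brace_quotient[OF I] .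
  note homs = quotient_homs[OF I]
  interpret h: group_hom "add_monoid X" "add_monoid ?Q" ?h
    using homs(1) additive.group_axioms Q.additive.group_axioms
    by (simp add: group_hom_def group_hom_axioms_def)
  have "?h ` S \<subseteq> left_series ?Q n" for n
  proof (induction n)
    case 0
    then show ?case using S by (auto simp: carrier_quotient)
  next
    case (Suc n)
    let ?G = "{star X s t | s t. s \<in> S \<and> t \<in> S}"
    have G: "?G \<subseteq> carrier (add_monoid X)" using S by (auto intro: star_closed)
    have "?h ` S \<subseteq> ?h ` generate (add_monoid X) ?G"
      using perfect unfolding set_star_def by (rule image_mono)
    also have "\<dots> = generate (add_monoid ?Q) (?h ` ?G)"
      by (rule h.generate_img[OF G, symmetric])
    also have "\<dots> \<subseteq> set_star ?Q (carrier ?Q) (left_series ?Q n)"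
      unfolding set_star_def
    proof (rule Q.additive.mono_generate, clarify)
      fix s t assume st: "s \<in> S" "t \<in> S"
      then have "?h (star X s t) = star ?Q (?h s) (?h t)"
        using hom_star[OF Q.skew_brace_axioms homs] S by blast
      moreover have "?h s \<in> carrier ?Q" "?h t \<in> left_series ?Q n"
        using st S Suc by (auto simp: carrier_quotient)
      ultimately show "\<exists>u v. ?h (star X s t) = star ?Q u v \<and> u \<in> carrier ?Q \<and> v \<in> left_series ?Q n"
        by blast
    qed
    finally show ?case by simp
  qed
  moreover obtain n where "left_series ?Q n = {\<zero>\<^bsub>?Q\<^esub>}"
    using nil unfolding left_nilpotent_def by blast
  ultimately have "?h ` S \<subseteq> {\<zero>\<^bsub>?Q\<^esub>}" by metis
  then have "?h x = \<zero>\<^bsub>?Q\<^esub>" using x by blast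
  then have "?h x = I" by (simp add: brace_quotient_def)
  then show "x \<in> I" using coset_eq_ideal_iff[OF I] x S by blast
qed

section \<open>The two chains\<close>

text \<open>
  The residual series takes stars and generated subgroups inside the restricted structure, the
  derived series in \<open>X\<close> itself; this lemma makes the two comparable.
\<close>

lemma set_star_restrict:
  assumes H: "subskew_brace H X" and ST: "S \<subseteq> H" "T \<subseteq> H"
  shows "set_star (X\<lparr>carrier := H\<rparr>) S T = set_star X S T"
proof -
  have a: "subgroup H (add_monoid X)" using H by (simp add: subskew_brace_def)
  have m: "subgroup H X" using H by (simp add: subskew_brace_def)
  interpret H: skew_brace "X\<lparr>carrier := H\<rparr>" using subskew_brace_imp_skew_brace[OF H] .
  have inv: "a_inv (X\<lparr>carrier := H\<rparr>) x = \<ominus> x" if "x \<in> H" for x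
    using additive.m_inv_consistent[OF a that] by (simp add: a_inv_def)
  have star: "star (X\<lparr>carrier := H\<rparr>) s t = star X s t" if "s \<in> S" "t \<in> T" for s t
    using that ST by (simp add: star_def brace_lambda_def a_minus_def inv subsetD)
  have eq: "{star (X\<lparr>carrier := H\<rparr>) s t | s t. s \<in> S \<and> t \<in> T} = {star X s t | s t. s \<in> S \<and> t \<in> T}"
    using star by (auto; metis)
  have "{star X s t | s t. s \<in> S \<and> t \<in> T} \<subseteq> H"
    using H.star_closed ST by (auto simp: star[symmetric] subsetD)
  then show ?thesis
    using additive.generate_consistent[OF _ a] by (simp add: set_star_def eq)
qed

lemma subskew_brace_trans:
  assumes "subskew_brace H X" "subskew_brace K (X\<lparr>carrier := H\<rparr>)"
  shows "subskew_brace K X"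
  using assms additive.incl_subgroup[of H K] multiplicative.incl_subgroup[of H K]
  by (simp add: subskew_brace_def)

lemma subskew_brace_restrict:
  assumes "subskew_brace K X" "subskew_brace H X" "K \<subseteq> H"
  shows "subskew_brace K (X\<lparr>carrier := H\<rparr>)"
  using assms additive.subgroup_incl[of K H] multiplicative.subgroup_incl[of K H]
  by (simp add: subskew_brace_def)

lemma subskew_brace_carrier: "subskew_brace (carrier X) X"
  unfolding subskew_brace_def
  using additive.subgroup_self multiplicative.subgroup_self by simp

lemma subskew_brace_subset: "subskew_brace H X \<Longrightarrow> H \<subseteq> carrier X"
  by (simp add: subskew_brace_def subgroup.subset)

lemma residual_step:
  assumes "subskew_brace H X"
  shows "subskew_brace (left_nilpotent_residual (X\<lparr>carrier := H\<rparr>)) X"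
    and "left_nilpotent_residual (X\<lparr>carrier := H\<rparr>) \<subseteq> set_star X H H"
    and "left_nilpotent_residual (X\<lparr>carrier := H\<rparr>) \<subseteq> H"
proof -
  interpret H: skew_brace "X\<lparr>carrier := H\<rparr>" using subskew_brace_imp_skew_brace[OF assms] .
  note s = H.brace_ideal_subskew_brace[OF H.brace_ideal_left_nilpotent_residual]
  show "subskew_brace (left_nilpotent_residual (X\<lparr>carrier := H\<rparr>)) X"
    by (rule subskew_brace_trans[OF assms s])
  show "left_nilpotent_residual (X\<lparr>carrier := H\<rparr>) \<subseteq> set_star X H H"
    using H.left_nilpotent_residual_subset_square set_star_restrict[OF assms] by simp
  show "left_nilpotent_residual (X\<lparr>carrier := H\<rparr>) \<subseteq> H"
    using H.subskew_brace_subset[OF s] by simp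
qed

lemma square_step:
  assumes "subskew_brace H X"
  shows "subskew_brace (set_star X H H) X" and "set_star X H H \<subseteq> H"
proof -
  interpret H: skew_brace "X\<lparr>carrier := H\<rparr>" using subskew_brace_imp_skew_brace[OF assms] .
  have s: "subskew_brace (set_star X H H) (X\<lparr>carrier := H\<rparr>)"
    using H.brace_ideal_subskew_brace[OF H.brace_ideal_square] set_star_restrict[OF assms] by simp
  show "subskew_brace (set_star X H H) X" by (rule subskew_brace_trans[OF assms s])
  show "set_star X H H \<subseteq> H" using H.subskew_brace_subset[OF s] by simp
qed

lemma residual_series_subskew_brace: "subskew_brace (residual_series X n) X"
  by (induction n) (simp_all add: subskew_brace_carrier residual_step)

lemma derived_star_series_subskew_brace: "subskew_brace (derived_star_series X n) X"
  by (induction n) (simp_all add: subskew_brace_carrier square_step)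

lemma residual_series_subset_derived: "residual_series X n \<subseteq> derived_star_series X n"
proof (induction n)
  case (Suc n)
  have "residual_series X (Suc n) \<subseteq> set_star X (residual_series X n) (residual_series X n)"
    using residual_step(2)[OF residual_series_subskew_brace] by simp
  also have "\<dots> \<subseteq> derived_star_series X (Suc n)"
    using set_star_mono[OF Suc Suc] by simp
  finally show ?case .
qed simp

lemma star_perfect_subset_residual_series:
  assumes S: "S \<subseteq> carrier X" "S \<subseteq> set_star X S S"
  shows "S \<subseteq> residual_series X n"
proof (induction n)
  case (Suc n)
  note R = residual_series_subskew_brace[of n]
  interpret R: skew_brace "X\<lparr>carrier := residual_series X n\<rparr>"
    using subskew_brace_imp_skew_brace[OF R] .
  show ?case
    using R.star_perfect_subset_residual[of S] Suc S(2) set_star_restrict[OF R Suc Suc] by simp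
qed (use S in simp)

lemma antimono_residual_series: "antimono (residual_series X)"
  by (simp add: antimono_iff_le_Suc residual_step(3)[OF residual_series_subskew_brace])

lemma antimono_derived_star_series: "antimono (derived_star_series X)"
  by (simp add: antimono_iff_le_Suc square_step(2)[OF derived_star_series_subskew_brace])

end

section \<open>Final terms of descending chains\<close>

lemma final_term_exists:
  fixes S :: "nat \<Rightarrow> 'a set"
  assumes dec: "antimono S" and fin: "finite (S 0)"
  shows "\<exists>T. is_final_term T S"
proof -
  \<comment> \<open>From a term of least cardinality on, the chain cannot shrink any more.\<close>
  obtain N where N: "\<And>n. card (S N) \<le> card (S n)"
    using ex_has_least_nat[of "\<lambda>_. True" _ "\<lambda>n. card (S n)"] by auto
  have "S n = S N" if "n \<ge> N" for n
  proof (rule card_seteq)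
    show "finite (S N)" using fin antimonoD[OF dec, of 0 N] by (simp add: finite_subset)
    show "S n \<subseteq> S N" using antimonoD[OF dec that] .
  qed (rule N)
  then show ?thesis unfolding is_final_term_def by blast
qed

lemma final_term_unique: "\<lbrakk>is_final_term T S; is_final_term T' S\<rbrakk> \<Longrightarrow> T = T'"
  unfolding is_final_term_def by (metis max.cobounded1 max.cobounded2)

lemma final_term_eq_bottom_iff:
  fixes S :: "nat \<Rightarrow> 'a set"
  assumes "is_final_term T S" "antimono S" "\<And>n. B \<subseteq> S n"
  shows "T = B \<longleftrightarrow> (\<exists>n. S n = B)"
proof
  show "\<exists>n. S n = B" if "T = B" using that assms(1) by (auto simp: is_final_term_def)
  assume "\<exists>n. S n = B"
  then obtain n where "S n = B" ..
  then have "is_final_term B S"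
    using assms(2,3) unfolding is_final_term_def antimono_def by (metis subset_antisym)
  then show "T = B" using final_term_unique assms(1) by blast
qed

theorem theorem7p6:
  fixes X :: "('a, 'm) ring_scheme"
  assumes "skew_brace X" and "finite (carrier X)"
  shows "(\<forall>n. subskew_brace (residual_series X n)
                (X\<lparr>carrier := derived_star_series X n\<rparr>)) \<and>
    is_final_term (P_L X) (residual_series X) \<and>
    is_final_term (P_L X) (derived_star_series X) \<and>
    (KSV_solvable X \<longleftrightarrow> (\<exists>n. residual_series X n = {\<zero>\<^bsub>X\<^esub>})) \<and>
    ((\<exists>n. residual_series X n = {\<zero>\<^bsub>X\<^esub>}) \<longleftrightarrow> P_L X = {\<zero>\<^bsub>X\<^esub>})"
proof -
  interpret skew_brace X by fact
  obtain T where T: "is_final_term T (residual_series X)"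
    using final_term_exists[OF antimono_residual_series] assms(2) by auto
  have P: "P_L X = T"
    unfolding P_L_def using T by (rule the_equality) (rule final_term_unique[OF _ T])
  obtain S where S: "is_final_term S (derived_star_series X)"
    using final_term_exists[OF antimono_derived_star_series] assms(2) by auto
  obtain M where M: "\<And>n. n \<ge> M \<Longrightarrow> derived_star_series X n = S"
    using S unfolding is_final_term_def by blast
  obtain N where N: "\<And>n. n \<ge> N \<Longrightarrow> residual_series X n = T"
    using T unfolding is_final_term_def by blast
  have perfect: "set_star X S S = S" using M[of M] M[of "Suc M"] by simp
  have "S \<subseteq> carrier X"
    using subskew_brace_subset[OF derived_star_series_subskew_brace[of M]] M by simp
  then have "S \<subseteq> T"
    using star_perfect_subset_residual_series[of S N] perfect N[of N] by simp
  moreover have "T \<subseteq> S"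
    using residual_series_subset_derived[of "max M N"] M N by simp
  ultimately have ST: "S = T" by blast
  have zero: "{\<zero>\<^bsub>X\<^esub>} \<subseteq> H" if "subskew_brace H X" for H
    using that subgroup.one_closed[of H "add_monoid X"] by (simp add: subskew_brace_def)
  have R0: "T = {\<zero>\<^bsub>X\<^esub>} \<longleftrightarrow> (\<exists>n. residual_series X n = {\<zero>\<^bsub>X\<^esub>})"
    by (rule final_term_eq_bottom_iff[OF T antimono_residual_series
          zero[OF residual_series_subskew_brace]])
  have D0: "S = {\<zero>\<^bsub>X\<^esub>} \<longleftrightarrow> (\<exists>n. derived_star_series X n = {\<zero>\<^bsub>X\<^esub>})"
    by (rule final_term_eq_bottom_iff[OF S antimono_derived_star_series
          zero[OF derived_star_series_subskew_brace]])
  have "subskew_brace (residual_series X n) (X\<lparr>carrier := derived_star_series X n\<rparr>)" for n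
    by (rule subskew_brace_restrict[OF residual_series_subskew_brace
          derived_star_series_subskew_brace residual_series_subset_derived])
  then show ?thesis
    using T S R0 D0 unfolding P ST KSV_solvable_def by simp
qed

end
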